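(* Fix $\kappa>1$. Among all $\beta\ge 0$ for which $\tau(\kappa,\beta)$ (defined in the context) exists, let $\beta(\kappa)$ denote the one that minimizes $\tau(\kappa,\beta)$. Then $$\beta(\kappa)=\frac{2\kappa-\sqrt{2\kappa-1}-1}{2\left(\kappa+\sqrt{2\kappa-1}\right)},\qquad \tau(\kappa,\beta(\kappa))=\sqrt{1-\frac{\sqrt{2\kappa-1}}{\kappa}}.$$
   Context: For $\kappa>1$ and $\beta\ge0$, $\tau(\kappa,\beta)$ denotes the smallest real number $\tau\in(0,1)$ such that $\omega=\tau^2$ satisfies $$-4(-\kappa+1)^2\beta^2(-2+\omega)+\omega(\kappa-1+\kappa\omega)^2-4(-\kappa+1)\beta\omega(-3\kappa+1+\kappa\omega)=0,$$ whenever such a $\tau$ exists (otherwise $\tau(\kappa,\beta)$ is undefined). *)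

theory Defs
  imports Complex_Main
begin

definition tau_root :: "real \<Rightarrow> real \<Rightarrow> real \<Rightarrow> bool" where
  "tau_root \<kappa> \<beta> \<tau> \<longleftrightarrow> 0 < \<tau> \<and> \<tau> < 1 \<and>
     (let \<omega> = \<tau>\<^sup>2 in
        - 4 * (- \<kappa> + 1)\<^sup>2 * \<beta>\<^sup>2 * (- 2 + \<omega>) + \<omega> * (\<kappa> - 1 + \<kappa> * \<omega>)\<^sup>2
          - 4 * (- \<kappa> + 1) * \<beta> * \<omega> * (- 3 * \<kappa> + 1 + \<kappa> * \<omega>) = 0)"

definition tau_exists :: "real \<Rightarrow> real \<Rightarrow> bool" where
  "tau_exists \<kappa> \<beta> \<longleftrightarrow> (\<exists>\<tau>. tau_root \<kappa> \<beta> \<tau> \<and> (\<forall>\<tau>'. tau_root \<kappa> \<beta> \<tau>' \<longrightarrow> \<tau> \<le> \<tau>'))"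

(* Meaningful only under tau_exists; otherwise an unspecified real. *)
definition tau :: "real \<Rightarrow> real \<Rightarrow> real" where
  "tau \<kappa> \<beta> = (LEAST \<tau>. tau_root \<kappa> \<beta> \<tau>)"

definition admissible :: "real \<Rightarrow> real \<Rightarrow> bool" where
  "admissible \<kappa> \<beta> \<longleftrightarrow> 0 \<le> \<beta> \<and> tau_exists \<kappa> \<beta>"

(* arg_min is a choice operator: it denotes the minimizer only if a unique one exists. *)
definition beta_opt :: "real \<Rightarrow> real" where
  "beta_opt \<kappa> = arg_min (tau \<kappa>) (admissible \<kappa>)"

end

theory Submission
  imports Defs
begin

text \<open>
  For fixed \<open>\<omega>\<close> the defining equation is a quadratic in \<open>\<beta>\<close>. Multiplying it by \<open>2 - \<omega>\<close> and completing
  the square turns it into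
  \<open>N\<^sup>2 + 2 * \<omega> * (1 - \<omega>) * (\<kappa>\<^sup>2 * (1 - \<omega>)\<^sup>2 - (2 * \<kappa> - 1)) = 0\<close>,
  where \<open>N\<close> is affine in \<open>\<beta>\<close> (lemma \<open>tau_poly_complete_square\<close>): the discriminant, a quartic in
  \<open>\<omega>\<close>, splits completely. For \<open>0 < \<omega> < 1\<close> the second summand must therefore be nonpositive, that is,
  \<open>\<omega> \<ge> 1 - sqrt (2 * \<kappa> - 1) / \<kappa>\<close>, whatever \<open>\<beta>\<close> is. Equality forces \<open>N = 0\<close>, which determines \<open>\<beta>\<close>, and
  conversely this \<open>\<beta>\<close> does attain the bound. So the bound is the minimum of \<open>\<tau>\<^sup>2\<close> over all roots
  \<open>\<tau>\<close> of all the equations, attained at exactly one \<open>\<beta>\<close>; that \<open>\<beta>\<close> is nonnegative, and since the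
  bound is global, the root there is automatically the smallest one for its \<open>\<beta>\<close>.

  The algebra at the optimum is rational in \<open>r = sqrt (2 * \<kappa> - 1) > 1\<close>, with \<open>\<kappa> = (r\<^sup>2 + 1) / 2\<close>.
\<close>

definition tau_poly :: "real \<Rightarrow> real \<Rightarrow> real \<Rightarrow> real" where
  "tau_poly \<kappa> \<beta> \<omega> =
     - 4 * (- \<kappa> + 1)\<^sup>2 * \<beta>\<^sup>2 * (- 2 + \<omega>) + \<omega> * (\<kappa> - 1 + \<kappa> * \<omega>)\<^sup>2
       - 4 * (- \<kappa> + 1) * \<beta> * \<omega> * (- 3 * \<kappa> + 1 + \<kappa> * \<omega>)"

lemma tau_root_iff_tau_poly:
  "tau_root \<kappa> \<beta> \<tau> \<longleftrightarrow> 0 < \<tau> \<and> \<tau> < 1 \<and> tau_poly \<kappa> \<beta> (\<tau>\<^sup>2) = 0"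
  by (simp add: tau_root_def tau_poly_def Let_def)

lemma tau_poly_complete_square:
  "(2 - \<omega>) * tau_poly \<kappa> \<beta> \<omega> =
     (2 * (\<kappa> - 1) * (2 - \<omega>) * \<beta> - \<omega> * (3 * \<kappa> - 1 - \<kappa> * \<omega>))\<^sup>2
     + 2 * \<omega> * (1 - \<omega>) * (\<kappa>\<^sup>2 * (1 - \<omega>)\<^sup>2 - (2 * \<kappa> - 1))"
  unfolding tau_poly_def by algebra

definition omega_min :: "real \<Rightarrow> real" where
  "omega_min \<kappa> = 1 - sqrt (2 * \<kappa> - 1) / \<kappa>"

definition beta_min :: "real \<Rightarrow> real" where
  "beta_min \<kappa> = (2 * \<kappa> - sqrt (2 * \<kappa> - 1) - 1) / (2 * (\<kappa> + sqrt (2 * \<kappa> - 1)))"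

lemma sqrt_parametrization:
  fixes \<kappa> :: real
  assumes "\<kappa> > 1"
  obtains r where "r > 1" "sqrt (2 * \<kappa> - 1) = r" "\<kappa> = (r\<^sup>2 + 1) / 2"
proof
  show "sqrt (2 * \<kappa> - 1) > 1" using assms by simp
  show "\<kappa> = ((sqrt (2 * \<kappa> - 1))\<^sup>2 + 1) / 2" using assms by simp
qed simp

lemma omega_min_bounds:
  assumes "\<kappa> > 1"
  shows "0 < omega_min \<kappa>" "omega_min \<kappa> < 1"
proof -
  obtain r where r: "r > 1" "sqrt (2 * \<kappa> - 1) = r" "\<kappa> = (r\<^sup>2 + 1) / 2"
    using sqrt_parametrization[OF assms] .
  have "(r - 1)\<^sup>2 > 0" using r(1) by simp
  then have "r < \<kappa>" by (simp add: r(3) power2_eq_square algebra_simps)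
  then show "0 < omega_min \<kappa>" "omega_min \<kappa> < 1"
    using assms r(1) by (simp_all add: omega_min_def r(2))
qed

lemma beta_min_nonneg:
  assumes "\<kappa> > 1"
  shows "0 \<le> beta_min \<kappa>"
proof -
  obtain r where r: "r > 1" "sqrt (2 * \<kappa> - 1) = r" "\<kappa> = (r\<^sup>2 + 1) / 2"
    using sqrt_parametrization[OF assms] .
  have "r * (r - 1) \<ge> 0" using r(1) by simp
  moreover have "2 * \<kappa> - r - 1 = r * (r - 1)"
    by (simp add: r(3) power2_eq_square algebra_simps)
  ultimately show ?thesis
    unfolding beta_min_def r(2) using assms r(1) by simp
qed

text \<open>
  \<open>beta_min\<close> is the \<open>\<beta>\<close> at which the square in \<open>tau_poly_complete_square\<close> vanishes for
  \<open>\<omega> = omega_min \<kappa>\<close>.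
\<close>

lemma square_vanishes_iff:
  assumes "\<kappa> > 1"
  shows "2 * (\<kappa> - 1) * (2 - omega_min \<kappa>) * \<beta>
           - omega_min \<kappa> * (3 * \<kappa> - 1 - \<kappa> * omega_min \<kappa>) = 0
         \<longleftrightarrow> \<beta> = beta_min \<kappa>"
proof -
  define \<omega> where "\<omega> = omega_min \<kappa>"
  obtain r where r: "r > 1" "sqrt (2 * \<kappa> - 1) = r" "\<kappa> = (r\<^sup>2 + 1) / 2"
    using sqrt_parametrization[OF assms] .
  have k\<omega>: "\<kappa> * \<omega> = \<kappa> - r"
    using assms unfolding \<omega>_def omega_min_def r(2) by (simp add: field_simps)
  have pos: "2 * (\<kappa> - 1) * (2 - \<omega>) > 0"
    using assms omega_min_bounds[OF assms] by (simp add: \<omega>_def)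
  have "2 * (\<kappa> + r) * beta_min \<kappa> = r * (r - 1)"
    using assms r(1) by (simp add: beta_min_def r(2)) (simp add: r(3) power2_eq_square algebra_simps)
  \<comment> \<open>Multiplied by \<open>\<kappa>\<close>, the claim involves \<open>\<omega>\<close> only through \<open>\<kappa> * \<omega>\<close>, which is polynomial in \<open>r\<close>.\<close>
  have "\<kappa> * (2 * (\<kappa> - 1) * (2 - \<omega>) * beta_min \<kappa>)
      = (\<kappa> - 1) * (2 * (2 * \<kappa> - \<kappa> * \<omega>) * beta_min \<kappa>)"
    by algebra
  also have "\<dots> = (\<kappa> - 1) * (2 * (\<kappa> + r) * beta_min \<kappa>)"
    by (simp add: k\<omega>)
  also have "\<dots> = (\<kappa> - 1) * (r * (r - 1))"
    by (simp only: \<open>2 * (\<kappa> + r) * beta_min \<kappa> = r * (r - 1)\<close>)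
  also have "\<dots> = (\<kappa> - r) * (2 * \<kappa> - 1 + r)"
    by (simp add: r(3) field_simps power2_eq_square)
  also have "\<dots> = \<kappa> * (\<omega> * (3 * \<kappa> - 1 - \<kappa> * \<omega>))"
    unfolding mult.assoc[symmetric] k\<omega> by simp
  finally have "2 * (\<kappa> - 1) * (2 - \<omega>) * beta_min \<kappa> = \<omega> * (3 * \<kappa> - 1 - \<kappa> * \<omega>)"
    using assms by simp
  then have "2 * (\<kappa> - 1) * (2 - \<omega>) * \<beta> - \<omega> * (3 * \<kappa> - 1 - \<kappa> * \<omega>)
      = 2 * (\<kappa> - 1) * (2 - \<omega>) * (\<beta> - beta_min \<kappa>)"
    by (simp add: right_diff_distrib)
  then show ?thesis
    using pos by (auto simp: \<omega>_def)
qed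

text \<open>The other summand in \<open>tau_poly_complete_square\<close> vanishes at \<open>omega_min \<kappa>\<close> too.\<close>

lemma tau_poly_omega_min_eq_0_iff:
  assumes "\<kappa> > 1"
  shows "tau_poly \<kappa> \<beta> (omega_min \<kappa>) = 0 \<longleftrightarrow> \<beta> = beta_min \<kappa>"
proof -
  have "\<kappa> * (1 - omega_min \<kappa>) = sqrt (2 * \<kappa> - 1)"
    using assms by (simp add: omega_min_def)
  then have "\<kappa>\<^sup>2 * (1 - omega_min \<kappa>)\<^sup>2 = 2 * \<kappa> - 1"
    using assms by (simp flip: power_mult_distrib)
  then have "(2 - omega_min \<kappa>) * tau_poly \<kappa> \<beta> (omega_min \<kappa>)
      = (2 * (\<kappa> - 1) * (2 - omega_min \<kappa>) * \<beta>
           - omega_min \<kappa> * (3 * \<kappa> - 1 - \<kappa> * omega_min \<kappa>))\<^sup>2"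
    by (simp add: tau_poly_complete_square)
  moreover have "2 - omega_min \<kappa> \<noteq> 0"
    using omega_min_bounds[OF assms] by simp
  ultimately show ?thesis
    using square_vanishes_iff[OF assms, of \<beta>] by (metis mult_eq_0_iff zero_eq_power2)
qed

text \<open>
  If \<open>\<omega>\<close> were below \<open>omega_min \<kappa>\<close>, the second summand in \<open>tau_poly_complete_square\<close> would be
  positive, and no \<open>\<beta>\<close> could make the sum vanish.
\<close>

lemma omega_min_le_root:
  assumes "\<kappa> > 1" "0 < \<omega>" "\<omega> < 1" "tau_poly \<kappa> \<beta> \<omega> = 0"
  shows "omega_min \<kappa> \<le> \<omega>"
proof (rule ccontr)
  assume "\<not> omega_min \<kappa> \<le> \<omega>"
  then have "sqrt (2 * \<kappa> - 1) < \<kappa> * (1 - \<omega>)"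
    using assms by (simp add: omega_min_def field_simps)
  then have "(sqrt (2 * \<kappa> - 1))\<^sup>2 < (\<kappa> * (1 - \<omega>))\<^sup>2"
    using assms by (intro power_strict_mono) auto
  then have "0 < \<kappa>\<^sup>2 * (1 - \<omega>)\<^sup>2 - (2 * \<kappa> - 1)"
    using assms by (simp add: power_mult_distrib)
  then have "0 < 2 * \<omega> * (1 - \<omega>) * (\<kappa>\<^sup>2 * (1 - \<omega>)\<^sup>2 - (2 * \<kappa> - 1))"
    using assms by simp
  then have "0 < (2 - \<omega>) * tau_poly \<kappa> \<beta> \<omega>"
    unfolding tau_poly_complete_square by (simp add: add_nonneg_pos)
  then show False using assms by simp
qed

lemma sqrt_omega_min_le_tau_root:
  assumes "\<kappa> > 1" "tau_root \<kappa> \<beta> \<tau>"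
  shows "sqrt (omega_min \<kappa>) \<le> \<tau>"
proof -
  have "0 < \<tau>\<^sup>2" "\<tau>\<^sup>2 < 1" "tau_poly \<kappa> \<beta> (\<tau>\<^sup>2) = 0" "0 < \<tau>"
    using assms(2) by (auto simp: tau_root_iff_tau_poly power_less_one_iff)
  then show ?thesis
    using omega_min_le_root[OF assms(1)] by (simp add: real_le_lsqrt)
qed

lemma tau_root_sqrt_omega_min_iff:
  assumes "\<kappa> > 1"
  shows "tau_root \<kappa> \<beta> (sqrt (omega_min \<kappa>)) \<longleftrightarrow> \<beta> = beta_min \<kappa>"
  using omega_min_bounds[OF assms] tau_poly_omega_min_eq_0_iff[OF assms]
  by (simp add: tau_root_iff_tau_poly)

lemma tau_root_tau:
  assumes "tau_exists \<kappa> \<beta>"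
  shows "tau_root \<kappa> \<beta> (tau \<kappa> \<beta>)"
proof -
  obtain t where "tau_root \<kappa> \<beta> t" "\<And>t'. tau_root \<kappa> \<beta> t' \<Longrightarrow> t \<le> t'"
    using assms unfolding tau_exists_def by blast
  then show ?thesis unfolding tau_def by (rule LeastI2_order)
qed

lemma admissible_beta_min:
  assumes "\<kappa> > 1"
  shows "admissible \<kappa> (beta_min \<kappa>)"
  unfolding admissible_def tau_exists_def
  using beta_min_nonneg[OF assms] tau_root_sqrt_omega_min_iff[OF assms]
    sqrt_omega_min_le_tau_root[OF assms] by blast

lemma tau_beta_min:
  assumes "\<kappa> > 1"
  shows "tau \<kappa> (beta_min \<kappa>) = sqrt (omega_min \<kappa>)"
  unfolding tau_def
  using tau_root_sqrt_omega_min_iff[OF assms] sqrt_omega_min_le_tau_root[OF assms]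
  by (intro Least_equality) auto

lemma is_arg_min_tau_iff:
  assumes "\<kappa> > 1"
  shows "is_arg_min (tau \<kappa>) (admissible \<kappa>) \<beta> \<longleftrightarrow> \<beta> = beta_min \<kappa>"
proof
  assume "is_arg_min (tau \<kappa>) (admissible \<kappa>) \<beta>"
  then have root: "tau_root \<kappa> \<beta> (tau \<kappa> \<beta>)" and le: "tau \<kappa> \<beta> \<le> sqrt (omega_min \<kappa>)"
    using admissible_beta_min[OF assms] tau_beta_min[OF assms]
    by (auto simp: is_arg_min_linorder admissible_def intro: tau_root_tau)
  then have "tau \<kappa> \<beta> = sqrt (omega_min \<kappa>)"
    using sqrt_omega_min_le_tau_root[OF assms root] by simp
  then show "\<beta> = beta_min \<kappa>"
    using root tau_root_sqrt_omega_min_iff[OF assms] by simp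
next
  assume "\<beta> = beta_min \<kappa>"
  then show "is_arg_min (tau \<kappa>) (admissible \<kappa>) \<beta>"
    using admissible_beta_min[OF assms] tau_beta_min[OF assms]
      sqrt_omega_min_le_tau_root[OF assms]
    by (auto simp: is_arg_min_linorder admissible_def intro: tau_root_tau)
qed

theorem theorem5:
  fixes \<kappa> :: real
  assumes "\<kappa> > 1"
  shows "(\<exists>!\<beta>. is_arg_min (tau \<kappa>) (admissible \<kappa>) \<beta>)
       \<and> beta_opt \<kappa> = (2 * \<kappa> - sqrt (2 * \<kappa> - 1) - 1) / (2 * (\<kappa> + sqrt (2 * \<kappa> - 1)))
       \<and> tau \<kappa> (beta_opt \<kappa>) = sqrt (1 - sqrt (2 * \<kappa> - 1) / \<kappa>)"
proof -
  have "beta_opt \<kappa> = beta_min \<kappa>"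
    by (simp add: beta_opt_def arg_min_def is_arg_min_tau_iff[OF assms])
  then show ?thesis
    using is_arg_min_tau_iff[OF assms] tau_beta_min[OF assms]
    by (simp add: beta_min_def omega_min_def)
qed

end
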